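(* Let $\Omega,\Omega^*$ be bounded convex domains in $\mathbb R^n$. Let $p_1,\dots,p_N$ be distinct points in $\overline{\Omega^*}$, let $g_1,\dots,g_N$ be positive numbers, and let $f\in L^1(\Omega)$ be nonnegative with $$\int_{\overline\Omega}f(x)\,dx=\sum_{i=1}^Ng_i.$$ Then there exist positive numbers $b_1,b_2,\dots,b_N$ such that the convex function $$u(x)=\max_{1\le i\le N}\{x\cdot p_i+b_i\}$$ solves the second boundary value problem for the Monge-Amp\`ere equation with measure $\mu=\sum_{i=1}^Ng_i\delta_{p_i}$; that is, $u\in\mathcal F$, $\partial u(\overline\Omega)=\overline{\Omega^*}$, and $$\int_{(\partial u)^{-1}(E)}f(x)\,dx=\mu(E)\qquad\text{for each Borel set }E\subset\overline{\Omega^*}.$$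
   Context: For $u:\overline\Omega\to\mathbb R$ the subdifferential is (here restricted to slopes in $\overline{\Omega^*}$) $$\partial u(x_0)=\{p\in\overline{\Omega^*}:u(x)\ge u(x_0)+p\cdot(x-x_0)\text{ for all }x\in\overline\Omega\},\qquad x_0\in\overline\Omega.$$ $\partial u(\overline\Omega)=\bigcup_{x\in\overline\Omega}\partial u(x)$, and $(\partial u)^{-1}(E)=\{x\in\overline\Omega:\partial u(x)\cap E\ne\emptyset\}$. $\mathcal F=\{u\in C(\overline\Omega):u\text{ is convex and }\partial u(y)\cap\overline{\Omega^*}\neq\emptyset\ \forall y\in\overline\Omega\}$. *)

theory Defs
  imports "HOL-Analysis.Analysis" "HOL-Probability.Giry_Monad"
begin

text \<open>A domain is a nonempty open connected set; connectedness follows from convexity.\<close>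

definition bounded_convex_domain :: "(real ^ 'n) set \<Rightarrow> bool" where
  "bounded_convex_domain \<Omega> \<longleftrightarrow> open \<Omega> \<and> \<Omega> \<noteq> {} \<and> bounded \<Omega> \<and> convex \<Omega>"

text \<open>In what follows \<open>\<Omega>'\<close> is the target domain. Functions on the closure of \<open>\<Omega>\<close> are total
  functions of which only the values on that closure are used, and subdifferentials contain only
  slopes in the closure of \<open>\<Omega>'\<close>.\<close>

definition subdifferential ::
  "(real ^ 'n) set \<Rightarrow> (real ^ 'n) set \<Rightarrow> (real ^ 'n \<Rightarrow> real) \<Rightarrow> real ^ 'n \<Rightarrow> (real ^ 'n) set" where
  "subdifferential \<Omega> \<Omega>' u x0 =
     {p \<in> closure \<Omega>'. \<forall>x \<in> closure \<Omega>. u x \<ge> u x0 + p \<bullet> (x - x0)}"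

definition subdifferential_image ::
  "(real ^ 'n) set \<Rightarrow> (real ^ 'n) set \<Rightarrow> (real ^ 'n \<Rightarrow> real) \<Rightarrow> (real ^ 'n) set" where
  "subdifferential_image \<Omega> \<Omega>' u = (\<Union>x \<in> closure \<Omega>. subdifferential \<Omega> \<Omega>' u x)"

definition subdifferential_preimage ::
  "(real ^ 'n) set \<Rightarrow> (real ^ 'n) set \<Rightarrow> (real ^ 'n \<Rightarrow> real) \<Rightarrow> (real ^ 'n) set \<Rightarrow> (real ^ 'n) set" where
  "subdifferential_preimage \<Omega> \<Omega>' u E =
     {x \<in> closure \<Omega>. subdifferential \<Omega> \<Omega>' u x \<inter> E \<noteq> {}}"

definition admissible_functions ::
  "(real ^ 'n) set \<Rightarrow> (real ^ 'n) set \<Rightarrow> (real ^ 'n \<Rightarrow> real) set" where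
  "admissible_functions \<Omega> \<Omega>' =
     {u. continuous_on (closure \<Omega>) u \<and> convex_on (closure \<Omega>) u \<and>
         (\<forall>y \<in> closure \<Omega>. subdifferential \<Omega> \<Omega>' u y \<inter> closure \<Omega>' \<noteq> {})}"

text \<open>Measurability of the domain of integration is required explicitly, because the Bochner
  integral over a non-measurable set may default to \<open>0\<close>.\<close>

definition solves_second_bvp ::
  "(real ^ 'n) set \<Rightarrow> (real ^ 'n) set \<Rightarrow> (real ^ 'n \<Rightarrow> real) \<Rightarrow> (real ^ 'n) measure \<Rightarrow>
   (real ^ 'n \<Rightarrow> real) \<Rightarrow> bool" where
  "solves_second_bvp \<Omega> \<Omega>' f \<mu> u \<longleftrightarrow>
     u \<in> admissible_functions \<Omega> \<Omega>' \<and>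
     subdifferential_image \<Omega> \<Omega>' u = closure \<Omega>' \<and>
     (\<forall>E \<in> sets borel. E \<subseteq> closure \<Omega>' \<longrightarrow>
        subdifferential_preimage \<Omega> \<Omega>' u E \<in> sets lebesgue \<and>
        (LINT x:subdifferential_preimage \<Omega> \<Omega>' u E|lebesgue. f x) = measure \<mu> E)"

definition dirac_sum :: "nat \<Rightarrow> (nat \<Rightarrow> real) \<Rightarrow> (nat \<Rightarrow> real ^ 'n) \<Rightarrow> (real ^ 'n) measure" where
  "dirac_sum N g p =
     measure_of UNIV (sets borel) (\<lambda>E. \<Sum>i = 1..N. ennreal (g i) * emeasure (return borel (p i)) E)"

text \<open>The set function above is countably additive, so \<^const>\<open>measure_of\<close> does not default to
  the zero measure.\<close>

lemma sets_dirac_sum [simp]: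
  fixes p :: "nat \<Rightarrow> real ^ 'n"
  shows "sets (dirac_sum N g p) = sets borel"
proof -
  have "sigma_sets UNIV (sets (borel :: (real ^ 'n) measure)) = sets borel"
    using sets.sigma_sets_eq[of "borel :: (real ^ 'n) measure"] by (simp only: space_borel)
  then show ?thesis
    unfolding dirac_sum_def by (subst sets_measure_of) simp_all
qed

lemma emeasure_dirac_sum:
  fixes p :: "nat \<Rightarrow> real ^ 'n"
  assumes E: "E \<in> sets borel"
  shows "emeasure (dirac_sum N g p) E =
    (\<Sum>i = 1..N. ennreal (g i) * emeasure (return borel (p i)) E)"
proof (rule emeasure_measure_of[OF dirac_sum_def])
  show "positive (sets (dirac_sum N g p))
      (\<lambda>E. \<Sum>i = 1..N. ennreal (g i) * emeasure (return borel (p i)) E)"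
    by (simp add: positive_def)
  show "countably_additive (sets (dirac_sum N g p))
      (\<lambda>E. \<Sum>i = 1..N. ennreal (g i) * emeasure (return borel (p i)) E)"
  proof (rule countably_additiveI)
    fix A :: "nat \<Rightarrow> (real ^ 'n) set"
    assume A: "range A \<subseteq> sets (dirac_sum N g p)" "disjoint_family A"
    have "(\<Sum>k. \<Sum>i = 1..N. ennreal (g i) * emeasure (return borel (p i)) (A k)) =
        (\<Sum>i = 1..N. \<Sum>k. ennreal (g i) * emeasure (return borel (p i)) (A k))"
      by (rule suminf_sum) simp
    also have "\<dots> = (\<Sum>i = 1..N. ennreal (g i) * emeasure (return borel (p i)) (\<Union>k. A k))"
      using A by (simp add: suminf_emeasure del: emeasure_return)
    finally show "(\<Sum>k. \<Sum>i = 1..N. ennreal (g i) * emeasure (return borel (p i)) (A k)) =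
        (\<Sum>i = 1..N. ennreal (g i) * emeasure (return borel (p i)) (\<Union>k. A k))" .
  qed
qed (use E in auto)

end

theory Submission
  imports Defs
begin

text \<open>
  Where a maximum of affine functions has a single active piece, the slope of that piece is its only
  subgradient. The points of \<open>\<Omega>\<close> with several active pieces lie on finitely many hyperplanes, which
  are null sets, and so is the frontier of a convex set. Hence the measure condition asks for shifts
  \<open>b\<close> such that, for each \<open>i\<close>, the set on which the \<open>i\<close>-th piece is active has \<open>f\<close>-mass \<open>g i\<close>. This
  is a semi-discrete optimal transport problem.

  Such shifts are found by minimising the Kantorovich dual \<open>\<Phi>\<close>, whose value
  at \<open>b\<close> is the integral of the maximum of the functions \<open>x \<bullet> p i + b i\<close> against \<open>f\<close>, less the sum
  of the \<open>g i * b i\<close>. Since \<open>f\<close> and \<open>g\<close> have the same total mass, \<open>\<Phi>\<close> does not change when a constant is added to all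
  shifts, so one may normalise the largest shift to \<open>0\<close>. Then \<open>\<Phi>\<close> tends to infinity as any shift
  tends to \<open>-\<infinity>\<close> (\<open>dual_functional_coercive\<close>), and a minimiser exists by compactness
  (\<open>dual_functional_has_minimizer\<close>). Raising the \<open>k\<close>-th shift slightly cannot decrease \<open>\<Phi>\<close>, which
  gives the cell of \<open>k\<close> mass at least \<open>g k\<close> (\<open>minimizer_cell_measure_ge\<close>). The opposite
  inequality comes from counting: the cells overlap in null sets, so their masses add up to at most
  the total of the \<open>g k\<close>, and every inequality is an equality. This part works for integrable
  functions on any finite measure space, as long as the difference of any two of them takes each
  value only on a null set (\<open>exists_prescribed_cell_measures\<close>).

  Translation invariance also makes the shifts positive. Every slope in the closure of the
  target is attained because a continuous function minus a linear one has a minimum on the compact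
  closure of \<open>\<Omega>\<close>.
\<close>

section \<open>Upper envelopes and their cells\<close>

definition upper_envelope :: "'i set \<Rightarrow> ('i \<Rightarrow> 'a \<Rightarrow> real) \<Rightarrow> ('i \<Rightarrow> real) \<Rightarrow> 'a \<Rightarrow> real" where
  "upper_envelope I l b x = Max ((\<lambda>i. l i x + b i) ` I)"

definition envelope_cell :: "'i set \<Rightarrow> ('i \<Rightarrow> 'a \<Rightarrow> real) \<Rightarrow> ('i \<Rightarrow> real) \<Rightarrow> 'i \<Rightarrow> 'a set" where
  "envelope_cell I l b i = {x. \<forall>j\<in>I. l j x + b j \<le> l i x + b i}"

lemma upper_envelope_ge:
  "finite I \<Longrightarrow> i \<in> I \<Longrightarrow> l i x + b i \<le> upper_envelope I l b x"
  by (simp add: upper_envelope_def)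

lemma upper_envelope_le_iff:
  "finite I \<Longrightarrow> I \<noteq> {} \<Longrightarrow> upper_envelope I l b x \<le> c \<longleftrightarrow> (\<forall>i\<in>I. l i x + b i \<le> c)"
  by (simp add: upper_envelope_def)

lemma upper_envelope_eq_on_cell:
  assumes "finite I" "i \<in> I" "x \<in> envelope_cell I l b i"
  shows "upper_envelope I l b x = l i x + b i"
proof (rule antisym)
  have "I \<noteq> {}" using assms by auto
  then show "upper_envelope I l b x \<le> l i x + b i"
    using assms by (simp add: upper_envelope_le_iff envelope_cell_def)
qed (use assms in \<open>simp add: upper_envelope_ge\<close>)

lemma envelope_cells_cover:
  assumes "finite I" "I \<noteq> {}"
  obtains i where "i \<in> I" "x \<in> envelope_cell I l b i"
proof -
  have "upper_envelope I l b x \<in> (\<lambda>i. l i x + b i) ` I"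
    unfolding upper_envelope_def using assms by (intro Max_in) auto
  then obtain i where i: "i \<in> I" "upper_envelope I l b x = l i x + b i" by auto
  then have "x \<in> envelope_cell I l b i"
    using upper_envelope_ge[OF assms(1), of _ l x b] by (force simp: envelope_cell_def)
  with i show ?thesis using that by blast
qed

lemma upper_envelope_lipschitz:
  assumes "finite I" "I \<noteq> {}"
  shows "\<bar>upper_envelope I l b x - upper_envelope I l c x\<bar> \<le> (\<Sum>i\<in>I. \<bar>b i - c i\<bar>)"
proof -
  have *: "upper_envelope I l b x \<le> upper_envelope I l c x + (\<Sum>i\<in>I. \<bar>b i - c i\<bar>)" for b c
  proof (subst upper_envelope_le_iff[OF assms], intro ballI)
    fix i assume "i \<in> I"
    then have "\<bar>b i - c i\<bar> \<le> (\<Sum>i\<in>I. \<bar>b i - c i\<bar>)"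
      using assms by (intro member_le_sum) auto
    with upper_envelope_ge[OF assms(1) \<open>i \<in> I\<close>, of l x c]
    show "l i x + b i \<le> upper_envelope I l c x + (\<Sum>i\<in>I. \<bar>b i - c i\<bar>)" by linarith
  qed
  from *[of b c] *[of c b] show ?thesis by (simp add: abs_minus_commute)
qed

lemma upper_envelope_abs_le:
  assumes "finite I" "I \<noteq> {}"
  shows "\<bar>upper_envelope I l b x\<bar> \<le> (\<Sum>i\<in>I. \<bar>l i x\<bar>) + (\<Sum>i\<in>I. \<bar>b i\<bar>)"
proof -
  obtain i where i: "i \<in> I" "x \<in> envelope_cell I l b i"
    using envelope_cells_cover[OF assms] by metis
  have "\<bar>l i x\<bar> \<le> (\<Sum>i\<in>I. \<bar>l i x\<bar>)" "\<bar>b i\<bar> \<le> (\<Sum>i\<in>I. \<bar>b i\<bar>)"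
    using assms i by (auto intro!: member_le_sum)
  then show ?thesis using upper_envelope_eq_on_cell[OF assms(1) i] by simp
qed

lemma upper_envelope_shift:
  assumes "finite I" "I \<noteq> {}" "\<And>i. i \<in> I \<Longrightarrow> c i = b i + d"
  shows "upper_envelope I l c x = upper_envelope I l b x + d"
proof -
  obtain i where i: "i \<in> I" "x \<in> envelope_cell I l b i"
    using envelope_cells_cover[OF assms(1,2)] by metis
  then have "x \<in> envelope_cell I l c i" using assms(3) by (auto simp: envelope_cell_def)
  then show ?thesis
    using upper_envelope_eq_on_cell[OF assms(1) i] upper_envelope_eq_on_cell[OF assms(1) i(1), of x l c]
      assms(3)[OF i(1)] by simp
qed

lemma envelope_cell_shift:
  "i \<in> I \<Longrightarrow> (\<And>j. j \<in> I \<Longrightarrow> c j = b j + d) \<Longrightarrow> envelope_cell I l c i = envelope_cell I l b i"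
  by (auto simp: envelope_cell_def)

section \<open>Minimising the dual functional\<close>

text \<open>For the cost \<open>- l i x\<close>, this is the dual of transporting \<open>M\<close> to the discrete measure with
  masses \<open>g i\<close>: for given \<open>b\<close> the optimal potential on the side of \<open>M\<close> is the upper envelope.\<close>

definition dual_functional ::
  "'a measure \<Rightarrow> 'i set \<Rightarrow> ('i \<Rightarrow> 'a \<Rightarrow> real) \<Rightarrow> ('i \<Rightarrow> real) \<Rightarrow> ('i \<Rightarrow> real) \<Rightarrow> real" where
  "dual_functional M I l g b = (\<integral>x. upper_envelope I l b x \<partial>M) - (\<Sum>i\<in>I. g i * b i)"

context finite_measure
begin

lemma integrable_upper_envelope:
  assumes "finite I" "I \<noteq> {}" "\<And>i. i \<in> I \<Longrightarrow> integrable M (l i)"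
  shows "integrable M (upper_envelope I l b)"
proof (rule Bochner_Integration.integrable_bound)
  show "integrable M (\<lambda>x. (\<Sum>i\<in>I. \<bar>l i x\<bar>) + (\<Sum>i\<in>I. \<bar>b i\<bar>))"
    using assms by auto
  have [measurable]: "\<And>i. i \<in> I \<Longrightarrow> l i \<in> borel_measurable M" using assms by auto
  have "(\<lambda>x. Max ((\<lambda>i. l i x + b i) ` I)) \<in> borel_measurable M"
    using assms(1) by measurable
  then show "upper_envelope I l b \<in> borel_measurable M"
    by (simp add: upper_envelope_def[abs_def])
  show "AE x in M. norm (upper_envelope I l b x)
      \<le> norm ((\<Sum>i\<in>I. \<bar>l i x\<bar>) + (\<Sum>i\<in>I. \<bar>b i\<bar>))"
    using upper_envelope_abs_le[OF assms(1,2), of l b] by (auto intro!: AE_I2 order_trans[OF _ abs_ge_self])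
qed

text \<open>The topology on the shifts is that of pointwise convergence. Continuity follows from the
  Lipschitz bound on the envelope in the shifts indexed by the finite set \<open>I\<close>.\<close>

lemma continuous_on_dual_functional:
  assumes I: "finite I" "I \<noteq> {}" and l: "\<And>i. i \<in> I \<Longrightarrow> integrable M (l i)"
  shows "continuous_on UNIV (dual_functional M I l g)"
proof -
  have "continuous_on UNIV (\<lambda>b. \<integral>x. upper_envelope I l b x \<partial>M)"
    unfolding continuous_on_def
  proof
    fix c :: "'b \<Rightarrow> real"
    have "continuous_on UNIV (\<lambda>b::'b \<Rightarrow> real. (\<Sum>i\<in>I. \<bar>b i - c i\<bar>) * measure M (space M))"
      by (intro continuous_intros continuous_on_product_coordinates)
    then have lim: "((\<lambda>b. (\<Sum>i\<in>I. \<bar>b i - c i\<bar>) * measure M (space M)) \<longlongrightarrow> 0) (at c)"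
      unfolding continuous_on_def using UNIV_I[of c] by (auto dest!: spec[of _ c])
    have bound: "norm ((\<integral>x. upper_envelope I l b x \<partial>M) - (\<integral>x. upper_envelope I l c x \<partial>M))
        \<le> (\<Sum>i\<in>I. \<bar>b i - c i\<bar>) * measure M (space M)" for b
    proof -
      note int = integrable_upper_envelope[OF I l]
      have "norm ((\<integral>x. upper_envelope I l b x \<partial>M) - (\<integral>x. upper_envelope I l c x \<partial>M))
          = norm (\<integral>x. upper_envelope I l b x - upper_envelope I l c x \<partial>M)"
        by (simp add: Bochner_Integration.integral_diff[OF int int])
      also have "\<dots> \<le> (\<integral>x. norm (upper_envelope I l b x - upper_envelope I l c x) \<partial>M)"
        by (rule integral_norm_bound)
      also have "\<dots> \<le> (\<integral>x. (\<Sum>i\<in>I. \<bar>b i - c i\<bar>) \<partial>M)"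
        using upper_envelope_lipschitz[OF I, of l b _ c] int
        by (intro integral_mono) auto
      finally show ?thesis by (simp add: mult.commute)
    qed
    show "((\<lambda>b. \<integral>x. upper_envelope I l b x \<partial>M) \<longlongrightarrow> (\<integral>x. upper_envelope I l c x \<partial>M)) (at c)"
      by (rule LIM_zero_cancel, rule Lim_null_comparison[OF _ lim]) (use bound in simp)
  qed
  then show ?thesis
    unfolding dual_functional_def[abs_def]
    by (intro continuous_intros continuous_on_product_coordinates)
qed

lemma dual_functional_shift:
  assumes I: "finite I" "I \<noteq> {}" and l: "\<And>i. i \<in> I \<Longrightarrow> integrable M (l i)"
    and mass: "(\<Sum>i\<in>I. g i) = measure M (space M)"
    and c: "\<And>i. i \<in> I \<Longrightarrow> c i = b i + d"
  shows "dual_functional M I l g c = dual_functional M I l g b"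
proof -
  have "(\<Sum>i\<in>I. g i * c i) = (\<Sum>i\<in>I. g i * b i) + (\<Sum>i\<in>I. g i) * d"
    using c by (simp add: algebra_simps sum.distrib sum_distrib_left)
  moreover have "(\<integral>x. upper_envelope I l c x \<partial>M)
      = (\<integral>x. upper_envelope I l b x \<partial>M) + measure M (space M) * d"
    using integrable_upper_envelope[OF I l]
    by (simp add: upper_envelope_shift[OF I c] Bochner_Integration.integral_add)
  ultimately show ?thesis by (simp add: dual_functional_def mass)
qed

text \<open>With largest shift \<open>0\<close>, the envelope is bounded below by a fixed integrable function, while
  every summand of the linear term has a favourable sign and can be discarded except the \<open>j\<close>-th.\<close>

lemma dual_functional_coercive:
  assumes I: "finite I" and l: "\<And>i. i \<in> I \<Longrightarrow> integrable M (l i)"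
    and g: "\<And>i. i \<in> I \<Longrightarrow> 0 < g i"
    and k: "k \<in> I" "b k = 0" and b: "\<And>i. i \<in> I \<Longrightarrow> b i \<le> 0" and j: "j \<in> I"
  shows "- g j * b j - (\<integral>x. (\<Sum>i\<in>I. \<bar>l i x\<bar>) \<partial>M) \<le> dual_functional M I l g b"
proof -
  have ne: "I \<noteq> {}" using k by auto
  have "(\<integral>x. - (\<Sum>i\<in>I. \<bar>l i x\<bar>) \<partial>M) \<le> (\<integral>x. upper_envelope I l b x \<partial>M)"
  proof (rule integral_mono)
    show "integrable M (\<lambda>x. - (\<Sum>i\<in>I. \<bar>l i x\<bar>))" using l by auto
    show "integrable M (upper_envelope I l b)" by (rule integrable_upper_envelope[OF I ne l])
    fix x
    have "\<bar>l k x\<bar> \<le> (\<Sum>i\<in>I. \<bar>l i x\<bar>)" using I k by (intro member_le_sum) auto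
    then show "- (\<Sum>i\<in>I. \<bar>l i x\<bar>) \<le> upper_envelope I l b x"
      using upper_envelope_ge[OF I k(1), of l x b] k(2) by simp
  qed
  moreover have "g j * - b j \<le> (\<Sum>i\<in>I. g i * - b i)"
    using I j g b by (intro member_le_sum mult_nonneg_nonneg) (auto intro: less_imp_le)
  ultimately show ?thesis by (simp add: dual_functional_def sum_negf)
qed

text \<open>Minimisation over a compact box suffices: outside it, a normalised shift has a larger value
  than the zero shift, by coercivity.\<close>

lemma dual_functional_has_minimizer:
  fixes I :: "'i set"
  assumes I: "finite I" "I \<noteq> {}" and l: "\<And>i. i \<in> I \<Longrightarrow> integrable M (l i)"
    and g: "\<And>i. i \<in> I \<Longrightarrow> 0 < g i"
    and mass: "(\<Sum>i\<in>I. g i) = measure M (space M)"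
  obtains b where "\<And>c. dual_functional M I l g b \<le> dual_functional M I l g c"
proof -
  define A where "A = (\<integral>x. (\<Sum>i\<in>I. \<bar>l i x\<bar>) \<partial>M)"
  \<comment> \<open>The value at zero shifts is at most \<open>A\<close>, while coercivity gives more than \<open>A\<close> as soon as
    \<open>- g j * b j > 2 * A\<close>; this fixes the side lengths of the box. Outside \<open>I\<close> the shifts are pinned
    to \<open>0\<close> to keep the product compact.\<close>
  define S where "S i = (if i \<in> I then {- (2 * A) / g i .. 0} else {0})" for i
  define K where "K = PiE UNIV S"
  have A: "A \<ge> 0" unfolding A_def by (intro Bochner_Integration.integral_nonneg sum_nonneg) auto
  have "compactin (product_topology (\<lambda>_. euclidean) UNIV) K"
    unfolding K_def compactin_PiE by (auto simp: S_def)
  then have "compact K"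
    by (simp add: euclidean_product_topology)
  moreover have zero: "(\<lambda>_. 0) \<in> K"
    using A g by (auto simp: K_def S_def intro!: divide_nonneg_pos)
  moreover have "continuous_on K (dual_functional M I l g)"
    by (rule continuous_on_subset[OF continuous_on_dual_functional[OF I l]]) auto
  ultimately obtain b where "b \<in> K"
    and min: "\<And>c. c \<in> K \<Longrightarrow> dual_functional M I l g b \<le> dual_functional M I l g c"
    using continuous_attains_inf[of K "dual_functional M I l g"] by blast
  have le_A: "dual_functional M I l g b \<le> A"
  proof -
    have "(\<integral>x. upper_envelope I l (\<lambda>_. 0) x \<partial>M) \<le> A"
      unfolding A_def
    proof (rule integral_mono)
      show "integrable M (upper_envelope I l (\<lambda>_. 0))" by (rule integrable_upper_envelope[OF I l])
      show "integrable M (\<lambda>x. \<Sum>i\<in>I. \<bar>l i x\<bar>)" using l by auto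
      show "upper_envelope I l (\<lambda>_. 0) x \<le> (\<Sum>i\<in>I. \<bar>l i x\<bar>)" for x
        using upper_envelope_abs_le[OF I, of l "\<lambda>_. 0" x] by simp
    qed
    with min[OF zero] show ?thesis by (simp add: dual_functional_def)
  qed
  have "dual_functional M I l g b \<le> dual_functional M I l g c" for c
  proof -
    define c' where "c' i = (if i \<in> I then c i - Max (c ` I) else 0)" for i
    have "Max (c ` I) \<in> c ` I" using I by (intro Max_in) auto
    then obtain k where k: "k \<in> I" "c' k = 0" by (auto simp: c'_def)
    have neg: "\<And>i. i \<in> I \<Longrightarrow> c' i \<le> 0" using I by (simp add: c'_def)
    have eq: "dual_functional M I l g c' = dual_functional M I l g c"
      by (rule dual_functional_shift[OF I l mass, where d = "- Max (c ` I)"]) (auto simp: c'_def)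
    show ?thesis
    proof (cases "c' \<in> K")
      case True
      from min[OF this] show ?thesis by (simp only: eq)
    next
      case False
      then obtain j where "c' j \<notin> S j" by (auto simp: K_def PiE_iff)
      then have j: "j \<in> I" "c' j < - (2 * A) / g j"
        using neg[of j] by (auto simp: S_def c'_def split: if_splits)
      then have "2 * A < - g j * c' j" using g[OF j(1)] by (simp add: field_simps)
      with dual_functional_coercive[where l = l and g = g and b = c' and k = k and j = j, OF I(1) l g k neg j(1)] eq le_A
      show ?thesis by (simp add: A_def)
    qed
  qed
  then show ?thesis using that by blast
qed

lemma sets_envelope_cell:
  assumes "finite I" "i \<in> I" "\<And>i. i \<in> I \<Longrightarrow> l i \<in> borel_measurable M"
  shows "space M \<inter> envelope_cell I l b i \<in> sets M"
proof -
  note [measurable] = assms(3)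
  have "{x \<in> space M. \<forall>j\<in>I. l j x + b j \<le> l i x + b i} \<in> sets M"
    using assms(1,2) by measurable
  also have "{x \<in> space M. \<forall>j\<in>I. l j x + b j \<le> l i x + b i} = space M \<inter> envelope_cell I l b i"
    by (auto simp: envelope_cell_def)
  finally show ?thesis .
qed

text \<open>Raising the \<open>k\<close>-th shift by \<open>t\<close> raises the envelope by at most \<open>t\<close>, and only on the set \<open>A t\<close>
  where the \<open>k\<close>-th function comes within \<open>t\<close> of the envelope. The linear term changes by \<open>t * g k\<close>,
  so minimality forces \<open>g k \<le> measure M (A t)\<close>. As \<open>t\<close> decreases to \<open>0\<close>, the sets \<open>A t\<close> shrink to
  the cell.\<close>

lemma minimizer_cell_measure_ge:
  assumes I: "finite I" and l: "\<And>i. i \<in> I \<Longrightarrow> integrable M (l i)"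
    and min: "\<And>c. dual_functional M I l g b \<le> dual_functional M I l g c"
    and k: "k \<in> I"
  shows "g k \<le> measure M (space M \<inter> envelope_cell I l b k)"
proof -
  have ne: "I \<noteq> {}" using k by auto
  let ?u = "upper_envelope I l b"
  define A where "A t = {x \<in> space M. ?u x \<le> l k x + b k + t}" for t
  note int = integrable_upper_envelope[OF I ne l]
  have [measurable]: "A t \<in> sets M" for t
  proof -
    have [measurable]: "?u \<in> borel_measurable M" "l k \<in> borel_measurable M" using int l k by auto
    show ?thesis unfolding A_def by measurable
  qed
  have ge: "g k \<le> measure M (A t)" if t: "t > 0" for t
  proof -
    let ?c = "b(k := b k + t)"
    have "(\<integral>x. upper_envelope I l ?c x \<partial>M) \<le> (\<integral>x. ?u x + t * indicator (A t) x \<partial>M)"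
    proof (rule integral_mono)
      show "integrable M (upper_envelope I l ?c)" by (rule int)
      show "integrable M (\<lambda>x. ?u x + t * indicator (A t) x)"
        using int by (intro Bochner_Integration.integrable_add integrable_mult_right) (auto simp: emeasure_eq_measure)
      fix x assume x: "x \<in> space M"
      have "l i x + ?c i \<le> ?u x + t * indicator (A t) x" if "i \<in> I" for i
        using upper_envelope_ge[OF I that, of l x b] t x
        by (auto simp: A_def indicator_def)
      then show "upper_envelope I l ?c x \<le> ?u x + t * indicator (A t) x"
        using I ne by (simp add: upper_envelope_le_iff)
    qed
    also have "\<dots> = (\<integral>x. ?u x \<partial>M) + t * measure M (A t)"
      using int by (subst Bochner_Integration.integral_add) (auto simp: emeasure_eq_measure intro!: integrable_mult_right)
    finally have "(\<integral>x. upper_envelope I l ?c x \<partial>M) \<le> (\<integral>x. ?u x \<partial>M) + t * measure M (A t)" .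
    moreover have "(\<Sum>i\<in>I. g i * ?c i) = (\<Sum>i\<in>I. g i * b i) + g k * t"
      using I k by (simp add: sum.remove[of I k] algebra_simps)
    ultimately have "t * g k \<le> t * measure M (A t)"
      using min[of ?c] by (simp add: dual_functional_def mult.commute)
    then show ?thesis using t by simp
  qed
  have "(\<lambda>n. measure M (A (1 / Suc n))) \<longlonglongrightarrow> measure M (\<Inter>n. A (1 / Suc n))"
  proof (rule finite_Lim_measure_decseq)
    show "decseq (\<lambda>n. A (1 / Suc n))"
      unfolding decseq_def A_def
      by (auto elim!: order_trans simp: frac_le)
  qed auto
  then have "g k \<le> measure M (\<Inter>n. A (1 / Suc n))"
    by (rule LIMSEQ_le_const) (auto intro!: ge)
  also have "(\<Inter>n. A (1 / Suc n)) = space M \<inter> envelope_cell I l b k"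
  proof safe
    fix x assume x: "x \<in> (\<Inter>n. A (1 / Suc n))"
    show "x \<in> space M" using x by (auto simp: A_def)
    have "(\<lambda>n. l k x + b k + 1 / Suc n) \<longlonglongrightarrow> l k x + b k + 0"
      by (intro tendsto_intros LIMSEQ_inverse_real_of_nat[unfolded inverse_eq_divide])
    then have "?u x \<le> l k x + b k + 0"
      by (rule LIMSEQ_le_const) (use x in \<open>auto simp: A_def\<close>)
    then show "x \<in> envelope_cell I l b k"
      using I ne by (simp add: upper_envelope_le_iff envelope_cell_def)
  next
    fix x n assume "x \<in> space M" "x \<in> envelope_cell I l b k"
    then show "x \<in> A (1 / Suc n)"
      using upper_envelope_eq_on_cell[OF I k, of x l b] by (simp add: A_def)
  qed
  finally show ?thesis .
qed

lemma measure_union_envelope_cells: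
  assumes J: "finite I" "J \<subseteq> I" and l: "\<And>i. i \<in> I \<Longrightarrow> l i \<in> borel_measurable M"
    and ties: "\<And>i j c. i \<in> I \<Longrightarrow> j \<in> I \<Longrightarrow> i \<noteq> j \<Longrightarrow> AE x in M. l i x - l j x \<noteq> c"
  shows "measure M (\<Union>i\<in>J. space M \<inter> envelope_cell I l b i)
    = (\<Sum>i\<in>J. measure M (space M \<inter> envelope_cell I l b i))"
proof (rule measure_UNION_AE)
  show "finite J" using J finite_subset by blast
  show "space M \<inter> envelope_cell I l b i \<in> fmeasurable M" if "i \<in> J" for i
    using sets_envelope_cell[OF J(1), of i l b] l that J by (auto simp: fmeasurable_eq_sets)
  show "pairwise (\<lambda>i j. AE x in M. x \<notin> space M \<inter> envelope_cell I l b i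
      \<or> x \<notin> space M \<inter> envelope_cell I l b j) J"
  proof (rule pairwiseI)
    fix i j assume ij: "i \<in> J" "j \<in> J" "i \<noteq> j"
    then have "AE x in M. l i x - l j x \<noteq> b j - b i" using ties J by blast
    then show "AE x in M. x \<notin> space M \<inter> envelope_cell I l b i
        \<or> x \<notin> space M \<inter> envelope_cell I l b j"
    proof eventually_elim
      case (elim x)
      have "i \<in> I" "j \<in> I" using ij J by auto
      with elim show ?case by (force simp: envelope_cell_def)
    qed
  qed
qed

text \<open>At a minimiser each cell has at least the required mass; since the cells are almost disjoint,
  there is no mass to exceed it.\<close>

theorem exists_prescribed_cell_measures:
  fixes I :: "'i set"
  assumes I: "finite I" "I \<noteq> {}" and l: "\<And>i. i \<in> I \<Longrightarrow> integrable M (l i)"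
    and g: "\<And>i. i \<in> I \<Longrightarrow> 0 < g i"
    and mass: "(\<Sum>i\<in>I. g i) = measure M (space M)"
    and ties: "\<And>i j c. i \<in> I \<Longrightarrow> j \<in> I \<Longrightarrow> i \<noteq> j \<Longrightarrow> AE x in M. l i x - l j x \<noteq> c"
  obtains b where "\<And>i. i \<in> I \<Longrightarrow> measure M (space M \<inter> envelope_cell I l b i) = g i"
proof -
  obtain b where min: "\<And>c. dual_functional M I l g b \<le> dual_functional M I l g c"
    using dual_functional_has_minimizer[where l = l and g = g, OF I l g mass] by blast
  let ?m = "\<lambda>i. measure M (space M \<inter> envelope_cell I l b i)"
  have ge: "g i \<le> ?m i" if "i \<in> I" for i
    by (rule minimizer_cell_measure_ge[OF I(1) l min that])
  have "(\<Sum>i\<in>I. ?m i) = measure M (\<Union>i\<in>I. space M \<inter> envelope_cell I l b i)"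
    by (rule measure_union_envelope_cells[symmetric]) (use I l ties in auto)
  also have "\<dots> \<le> (\<Sum>i\<in>I. g i)"
    unfolding mass by (rule bounded_measure)
  finally have "(\<Sum>i\<in>I. ?m i - g i) \<le> 0" by (simp add: sum_subtractf)
  moreover have "(\<Sum>i\<in>I. ?m i - g i) \<ge> 0" using ge by (intro sum_nonneg) auto
  ultimately have "\<forall>i\<in>I. ?m i - g i = 0"
    using sum_nonneg_eq_0_iff[of I "\<lambda>i. ?m i - g i"] I ge by auto
  then show ?thesis using that by auto
qed

end

section \<open>Subdifferentials of a maximum of affine functions\<close>

abbreviation affine_envelope ::
    "'i set \<Rightarrow> ('i \<Rightarrow> real ^ 'n) \<Rightarrow> ('i \<Rightarrow> real) \<Rightarrow> real ^ 'n \<Rightarrow> real" where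
  "affine_envelope I p \<equiv> upper_envelope I (\<lambda>i x. x \<bullet> p i)"

abbreviation power_cell ::
    "'i set \<Rightarrow> ('i \<Rightarrow> real ^ 'n) \<Rightarrow> ('i \<Rightarrow> real) \<Rightarrow> 'i \<Rightarrow> (real ^ 'n) set" where
  "power_cell I p \<equiv> envelope_cell I (\<lambda>i x. x \<bullet> p i)"

lemma continuous_on_affine_envelope:
  assumes "finite I" "I \<noteq> {}"
  shows "continuous_on S (affine_envelope I p b)"
proof -
  have "continuous_on S (\<lambda>x. Max ((\<lambda>i. x \<bullet> p i + b i) ` I))"
    using assms
  proof (induction I rule: finite_ne_induct)
    case (insert i I)
    then show ?case by (auto intro!: continuous_intros)
  qed (auto intro!: continuous_intros)
  then show ?thesis by (simp add: upper_envelope_def[abs_def])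
qed

lemma convex_on_affine_envelope:
  assumes "finite I" "I \<noteq> {}" "convex S"
  shows "convex_on S (affine_envelope I p b)"
proof (rule convex_onI)
  fix t :: real and x y assume t: "0 < t" "t < 1"
  let ?u = "affine_envelope I p b"
  show "?u ((1 - t) *\<^sub>R x + t *\<^sub>R y) \<le> (1 - t) * ?u x + t * ?u y"
  proof (subst upper_envelope_le_iff[OF assms(1,2)], intro ballI)
    fix i assume "i \<in> I"
    then have "(1 - t) * (x \<bullet> p i + b i) \<le> (1 - t) * ?u x" "t * (y \<bullet> p i + b i) \<le> t * ?u y"
      using t upper_envelope_ge[OF assms(1), of i "\<lambda>i x. x \<bullet> p i"] by (auto intro!: mult_left_mono)
    then show "((1 - t) *\<^sub>R x + t *\<^sub>R y) \<bullet> p i + b i \<le> (1 - t) * ?u x + t * ?u y"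
      by (simp add: inner_add_left algebra_simps)
  qed
qed (rule assms)

lemma slope_in_subdifferential:
  assumes "finite I" "i \<in> I" "p i \<in> closure \<Omega>'" "x \<in> power_cell I p b i"
  shows "p i \<in> subdifferential \<Omega> \<Omega>' (affine_envelope I p b) x"
  unfolding subdifferential_def
proof (intro CollectI conjI ballI)
  fix y
  have "y \<bullet> p i + b i \<le> affine_envelope I p b y"
    using upper_envelope_ge[OF assms(1,2), of "\<lambda>i x. x \<bullet> p i"] by simp
  then show "affine_envelope I p b x + p i \<bullet> (y - x) \<le> affine_envelope I p b y"
    using upper_envelope_eq_on_cell[OF assms(1,2,4)] by (simp add: inner_diff_right inner_commute)
qed (rule assms)

text \<open>Near \<open>x\<close> the envelope is affine with slope \<open>p k\<close>. Testing the subgradient inequality for \<open>q\<close> at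
  a nearby point in direction \<open>q - p k\<close> makes the squared norm of \<open>q - p k\<close> nonpositive.\<close>

lemma subdifferential_eq_slope:
  assumes I: "finite I" "k \<in> I" and \<Omega>: "open \<Omega>" "x \<in> \<Omega>" and q: "q \<in> subdifferential \<Omega> \<Omega>' (affine_envelope I p b) x"
    and strict: "\<And>j. j \<in> I \<Longrightarrow> j \<noteq> k \<Longrightarrow> x \<bullet> p j + b j < x \<bullet> p k + b k"
  shows "q = p k"
proof -
  let ?u = "affine_envelope I p b"
  define S where "S = \<Omega> \<inter> (\<Inter>j\<in>I - {k}. {y. y \<bullet> p j + b j < y \<bullet> p k + b k})"
  have "open S"
    unfolding S_def using I \<Omega>(1)
    by (intro open_Int open_INT ballI open_Collect_less continuous_intros) auto
  moreover have "x \<in> S" using \<Omega>(2) strict by (auto simp: S_def)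
  ultimately obtain e where e: "e > 0" "ball x e \<subseteq> S" by (meson open_contains_ball)
  have cell: "y \<in> power_cell I p b k" if "y \<in> S" for y
    unfolding envelope_cell_def
  proof (intro CollectI ballI)
    fix j assume "j \<in> I"
    then show "y \<bullet> p j + b j \<le> y \<bullet> p k + b k"
      using that by (cases "j = k") (auto simp: S_def intro: less_imp_le)
  qed
  define t where "t = e / (2 * (norm (q - p k) + 1))"
  have n: "norm (q - p k) + 1 > 0" using norm_ge_zero[of "q - p k"] by linarith
  have t: "t > 0" using e n by (simp add: t_def)
  let ?y = "x + t *\<^sub>R (q - p k)"
  have "t * norm (q - p k) < e"
  proof -
    have "t * norm (q - p k) \<le> t * (norm (q - p k) + 1)" using t by (simp add: mult_left_mono)
    also have "\<dots> = e / 2" using n by (simp add: t_def field_simps)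
    finally show ?thesis using e by simp
  qed
  then have y: "?y \<in> S" using e t by (intro subsetD[OF e(2)]) (simp add: dist_norm)
  then have "?y \<in> closure \<Omega>" using closure_subset by (auto simp: S_def)
  with q have "?u x + q \<bullet> (?y - x) \<le> ?u ?y" unfolding subdifferential_def by blast
  also have "?u ?y = ?y \<bullet> p k + b k"
    using upper_envelope_eq_on_cell[OF I cell[OF y]] by simp
  also have "?u x = x \<bullet> p k + b k"
    using upper_envelope_eq_on_cell[OF I cell[OF \<open>x \<in> S\<close>]] by simp
  finally have "t * ((q - p k) \<bullet> (q - p k)) \<le> 0"
    by (simp add: inner_add_left inner_diff_left inner_diff_right algebra_simps inner_commute)
  then have "(q - p k) \<bullet> (q - p k) \<le> 0"
    using t by (meson mult_pos_pos not_le)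
  then have "q - p k = 0"
    using inner_gt_zero_iff[of "q - p k"] by (meson not_le)
  then show ?thesis by simp
qed

lemma affine_envelope_admissible:
  assumes "finite I" "I \<noteq> {}" "p ` I \<subseteq> closure \<Omega>'" "convex \<Omega>"
  shows "affine_envelope I p b \<in> admissible_functions \<Omega> \<Omega>'"
  unfolding admissible_functions_def
proof (intro CollectI conjI ballI)
  show "continuous_on (closure \<Omega>) (affine_envelope I p b)"
    by (rule continuous_on_affine_envelope[OF assms(1,2)])
  show "convex_on (closure \<Omega>) (affine_envelope I p b)"
    using assms by (intro convex_on_affine_envelope convex_closure)
  fix y assume "y \<in> closure \<Omega>"
  obtain i where i: "i \<in> I" "y \<in> power_cell I p b i"
    using envelope_cells_cover[OF assms(1,2)] by metis
  then have "p i \<in> subdifferential \<Omega> \<Omega>' (affine_envelope I p b) y"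
    using assms by (intro slope_in_subdifferential) auto
  then show "subdifferential \<Omega> \<Omega>' (affine_envelope I p b) y \<inter> closure \<Omega>' \<noteq> {}"
    using i assms by auto
qed

text \<open>A slope \<open>q\<close> is a subgradient at every minimum of \<open>u x - q \<bullet> x\<close>.\<close>

lemma subdifferential_image_eq_closure:
  assumes "bounded \<Omega>" "\<Omega> \<noteq> {}" "continuous_on (closure \<Omega>) u"
  shows "subdifferential_image \<Omega> \<Omega>' u = closure \<Omega>'"
proof
  show "subdifferential_image \<Omega> \<Omega>' u \<subseteq> closure \<Omega>'"
    by (auto simp: subdifferential_image_def subdifferential_def)
  show "closure \<Omega>' \<subseteq> subdifferential_image \<Omega> \<Omega>' u"
  proof
    fix q assume q: "q \<in> closure \<Omega>'"
    have "continuous_on (closure \<Omega>) (\<lambda>x. u x - q \<bullet> x)"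
      using assms by (intro continuous_intros)
    then obtain x where "x \<in> closure \<Omega>" "\<And>y. y \<in> closure \<Omega> \<Longrightarrow> u x - q \<bullet> x \<le> u y - q \<bullet> y"
      using continuous_attains_inf[of "closure \<Omega>" "\<lambda>x. u x - q \<bullet> x"] assms
      by (auto simp: compact_closure)
    then have "q \<in> subdifferential \<Omega> \<Omega>' u x"
      using q by (force simp: subdifferential_def inner_diff_right)
    then show "q \<in> subdifferential_image \<Omega> \<Omega>' u"
      using \<open>x \<in> closure \<Omega>\<close> by (auto simp: subdifferential_image_def)
  qed
qed

lemma negligible_ridge:
  fixes v w :: "real ^ 'n"
  assumes "v \<noteq> w"
  shows "negligible {x. x \<bullet> v - x \<bullet> w = c}"
proof -
  have "{x. x \<bullet> v - x \<bullet> w = c} = {x. (v - w) \<bullet> x = c}"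
    by (simp add: inner_diff_left inner_diff_right inner_commute)
  then show ?thesis using assms negligible_hyperplane[of "v - w" c] by simp
qed

text \<open>The two sets can differ only on the frontier of \<open>\<Omega>\<close> and on the hyperplanes where two pieces
  agree. Slopes at frontier points are not controlled by the active pieces, as the supporting
  inequality there is tested on one side only. Beyond the comparison of masses, this gives the
  measurability of the preimage of an arbitrary set of slopes.\<close>

lemma subdifferential_preimage_symdiff_cells:
  fixes \<Omega> :: "(real ^ 'n) set" and b :: "'i \<Rightarrow> real"
  assumes I: "finite I" "I \<noteq> {}" and p: "inj_on p I" "p ` I \<subseteq> closure \<Omega>'"
    and \<Omega>: "open \<Omega>" "convex \<Omega>"
  defines "P \<equiv> \<lambda>E. subdifferential_preimage \<Omega> \<Omega>' (affine_envelope I p b) E"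
  defines "Q \<equiv> \<lambda>E. \<Omega> \<inter> (\<Union>i\<in>{i \<in> I. p i \<in> E}. power_cell I p b i)"
  shows "negligible ((Q E - P E) \<union> (P E - Q E))"
proof (rule negligible_subset)
  let ?R = "\<Union>(i, j)\<in>{(i, j). i \<in> I \<and> j \<in> I \<and> i \<noteq> j}. {x. x \<bullet> p i - x \<bullet> p j = b j - b i}"
  have "finite {(i, j). i \<in> I \<and> j \<in> I \<and> i \<noteq> j}"
    by (rule finite_subset[of _ "I \<times> I"]) (use I in auto)
  then have "negligible ?R"
    using p(1) by (intro negligible_Union) (auto intro!: negligible_ridge simp: inj_on_def)
  then show "negligible (frontier \<Omega> \<union> ?R)"
    using negligible_convex_frontier[OF \<Omega>(2)] by (rule negligible_Un[rotated])
  show "(Q E - P E) \<union> (P E - Q E) \<subseteq> frontier \<Omega> \<union> ?R"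
  proof
    fix x assume x: "x \<in> (Q E - P E) \<union> (P E - Q E)"
    have "Q E \<subseteq> P E"
    proof
      fix x assume "x \<in> Q E"
      then obtain i where i: "x \<in> \<Omega>" "i \<in> I" "p i \<in> E" "x \<in> power_cell I p b i"
        by (auto simp: Q_def)
      then have "p i \<in> subdifferential \<Omega> \<Omega>' (affine_envelope I p b) x"
        using I p by (intro slope_in_subdifferential) auto
      then show "x \<in> P E"
        using i closure_subset[of \<Omega>] by (auto simp: P_def subdifferential_preimage_def)
    qed
    with x have x: "x \<in> P E" "x \<notin> Q E" by auto
    then obtain q where q: "x \<in> closure \<Omega>" "q \<in> E"
        "q \<in> subdifferential \<Omega> \<Omega>' (affine_envelope I p b) x"
      by (auto simp: P_def subdifferential_preimage_def)
    obtain k where k: "k \<in> I" "x \<in> power_cell I p b k"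
      using envelope_cells_cover[OF I] by metis
    show "x \<in> frontier \<Omega> \<union> ?R"
    proof (rule ccontr)
      assume not: "x \<notin> frontier \<Omega> \<union> ?R"
      then have "x \<in> \<Omega>" using q \<Omega>(1) by (simp add: frontier_def interior_open)
      moreover have "x \<bullet> p j + b j < x \<bullet> p k + b k" if "j \<in> I" "j \<noteq> k" for j
      proof -
        have "x \<bullet> p k - x \<bullet> p j \<noteq> b j - b k" using not that k by auto
        moreover have "x \<bullet> p j + b j \<le> x \<bullet> p k + b k"
          using k that by (auto simp: envelope_cell_def)
        ultimately show ?thesis by linarith
      qed
      ultimately have "q = p k"
        using q by (intro subdifferential_eq_slope[OF I(1) k(1) \<Omega>(1)]) auto
      then have "x \<in> Q E" using \<open>x \<in> \<Omega>\<close> q k by (auto simp: Q_def)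
      then show False using x by simp
    qed
  qed
qed

section \<open>The second boundary value problem\<close>

lemma (in complete_measure) borel_measurable_AE_cong:
  fixes h h' :: "'a \<Rightarrow> real"
  assumes "h \<in> borel_measurable M" "AE x in M. h x = h' x"
  shows "h' \<in> borel_measurable M"
proof (rule measurableI)
  fix A :: "real set" assume A: "A \<in> sets borel"
  have "h -` A \<inter> space M \<in> sets M" using assms(1) A by (rule measurable_sets)
  moreover have "AE x in M. x \<in> h -` A \<inter> space M \<longleftrightarrow> x \<in> h' -` A \<inter> space M"
    using assms(2) by eventually_elim auto
  ultimately show "h' -` A \<inter> space M \<in> sets M"
    by (intro in_sets_AE[of "h -` A \<inter> space M" "h' -` A \<inter> space M"]) auto
qed simp

text \<open>The indicator cuts \<open>f\<close> off outside \<open>\<Omega>\<close>, where it need be neither measurable nor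
  nonnegative.\<close>

definition weighted_lebesgue :: "(real ^ 'n) set \<Rightarrow> (real ^ 'n \<Rightarrow> real) \<Rightarrow> (real ^ 'n) measure" where
  "weighted_lebesgue \<Omega> f = density lebesgue (\<lambda>x. ennreal (indicator \<Omega> x * f x))"

lemma sets_weighted_lebesgue [simp]: "sets (weighted_lebesgue \<Omega> f) = sets lebesgue"
  and space_weighted_lebesgue [simp]: "space (weighted_lebesgue \<Omega> f) = UNIV"
  by (simp_all add: weighted_lebesgue_def)

lemma finite_measure_weighted_lebesgue:
  assumes "set_integrable lebesgue \<Omega> f" "AE x\<in>\<Omega> in lebesgue. f x \<ge> 0"
  shows "finite_measure (weighted_lebesgue \<Omega> f)"
proof (rule finite_measureI)
  have "integrable lebesgue (\<lambda>x. indicator \<Omega> x * f x)"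
    using assms(1) by (simp add: set_integrable_def)
  moreover have "AE x in lebesgue. 0 \<le> indicator \<Omega> x * f x"
    using assms(2) by eventually_elim (auto simp: indicator_def)
  ultimately have "(\<integral>\<^sup>+x. ennreal (indicator \<Omega> x * f x) \<partial>lebesgue) \<noteq> \<infinity>"
    by (simp add: nn_integral_eq_integral)
  moreover have "emeasure (weighted_lebesgue \<Omega> f) UNIV
      = (\<integral>\<^sup>+x. ennreal (indicator \<Omega> x * f x) \<partial>lebesgue)"
    using \<open>integrable lebesgue (\<lambda>x. indicator \<Omega> x * f x)\<close>
    unfolding weighted_lebesgue_def by (subst emeasure_density) auto
  ultimately show "emeasure (weighted_lebesgue \<Omega> f) (space (weighted_lebesgue \<Omega> f)) \<noteq> \<infinity>"
    by simp
qed

lemma AE_weighted_lebesgueI: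
  assumes "set_integrable lebesgue \<Omega> f" "AE x\<in>\<Omega> in lebesgue. Q x"
  shows "AE x in weighted_lebesgue \<Omega> f. Q x"
proof -
  have "(\<lambda>x. indicator \<Omega> x * f x) \<in> borel_measurable lebesgue"
    using assms(1) by (auto simp: set_integrable_def)
  then show ?thesis
    unfolding weighted_lebesgue_def using assms(2)
    by (subst AE_density) (auto elim!: eventually_mono simp: indicator_def split: if_splits)
qed

lemma AE_notin_negligible: "negligible S \<Longrightarrow> AE x in lebesgue. x \<notin> S"
  by (intro AE_not_in) (simp add: negligible_iff_null_sets)

text \<open>On the frontier of \<open>\<Omega>\<close> the function \<open>f\<close> is arbitrary, so the measurability of the integrand on
  the right depends on completeness of Lebesgue measure and on the frontier being a null set.\<close>

lemma measure_weighted_lebesgue: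
  assumes f: "set_integrable lebesgue \<Omega> f" "AE x\<in>\<Omega> in lebesgue. f x \<ge> 0"
    and P: "P \<in> sets lebesgue" "P \<subseteq> closure \<Omega>" and \<Omega>: "open \<Omega>" "convex \<Omega>"
  shows "measure (weighted_lebesgue \<Omega> f) P = (LINT x:P|lebesgue. f x)"
proof -
  let ?M = "weighted_lebesgue \<Omega> f"
  have int: "integrable lebesgue (\<lambda>x. indicator \<Omega> x * f x)"
    using f(1) by (simp add: set_integrable_def)
  have nn: "AE x in lebesgue. 0 \<le> indicator \<Omega> x * f x"
    using f(2) by eventually_elim (auto simp: indicator_def)
  have "measure ?M P = (\<integral>x. indicator P x \<partial>?M)"
    using P by (simp add: weighted_lebesgue_def)
  also have "\<dots> = (\<integral>x. (indicator \<Omega> x * f x) *\<^sub>R (indicator P x :: real) \<partial>lebesgue)"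
    unfolding weighted_lebesgue_def using P int nn by (intro integral_density) auto
  also have "\<dots> = (LINT x:P|lebesgue. f x)"
    unfolding set_lebesgue_integral_def
  proof -
    have m: "(\<lambda>x. (indicator \<Omega> x * f x) *\<^sub>R (indicator P x :: real)) \<in> borel_measurable lebesgue"
      using int P by auto
    have ae: "AE x in lebesgue. (indicator \<Omega> x * f x) *\<^sub>R (indicator P x :: real) = indicator P x *\<^sub>R f x"
      using AE_notin_negligible[OF negligible_convex_frontier[OF \<Omega>(2)]]
      by eventually_elim
        (use P(2) \<Omega>(1) in \<open>auto simp: indicator_def frontier_def interior_open\<close>)
    show "(\<integral>x. (indicator \<Omega> x * f x) *\<^sub>R (indicator P x :: real) \<partial>lebesgue)
        = (\<integral>x. indicator P x *\<^sub>R f x \<partial>lebesgue)"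
      using m ae completion.borel_measurable_AE_cong[OF m ae] by (intro integral_cong_AE)
  qed
  finally show ?thesis .
qed

lemma measure_dirac_sum:
  assumes "E \<in> sets borel" "\<And>i. i \<in> {1..N} \<Longrightarrow> 0 < g i"
  shows "measure (dirac_sum N g p) E = (\<Sum>i\<in>{i \<in> {1..N}. p i \<in> E}. g i)"
proof -
  have "emeasure (dirac_sum N g p) E = (\<Sum>i = 1..N. if p i \<in> E then ennreal (g i) else 0)"
    unfolding emeasure_dirac_sum[OF assms(1)] by (intro sum.cong) (simp_all add: assms(1))
  also have "\<dots> = (\<Sum>i\<in>{i \<in> {1..N}. p i \<in> E}. ennreal (g i))"
    by (rule sum.mono_neutral_cong_right) auto
  also have "\<dots> = ennreal (\<Sum>i\<in>{i \<in> {1..N}. p i \<in> E}. g i)"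
    using assms(2) by (intro sum_ennreal) (auto intro: less_imp_le)
  finally show ?thesis
    unfolding measure_def using assms(2)
    by (simp only:) (intro enn2real_ennreal sum_nonneg, auto intro: less_imp_le)
qed

theorem theorem7p6:
  fixes \<Omega> \<Omega>' :: "(real ^ 'n) set" and N :: nat
    and p :: "nat \<Rightarrow> real ^ 'n" and g :: "nat \<Rightarrow> real" and f :: "real ^ 'n \<Rightarrow> real"
  assumes "bounded_convex_domain \<Omega>" and "bounded_convex_domain \<Omega>'"
    and "N \<ge> 1"
    and "inj_on p {1..N}" and "\<And>i. i \<in> {1..N} \<Longrightarrow> p i \<in> closure \<Omega>'"
    and "\<And>i. i \<in> {1..N} \<Longrightarrow> g i > 0"
    and "set_integrable lebesgue \<Omega> f" and "AE x\<in>\<Omega> in lebesgue. f x \<ge> 0"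
    and "(LINT x:closure \<Omega>|lebesgue. f x) = (\<Sum>i = 1..N. g i)"
  shows "\<exists>b :: nat \<Rightarrow> real. (\<forall>i \<in> {1..N}. b i > 0) \<and>
    solves_second_bvp \<Omega> \<Omega>' f (dirac_sum N g p) (\<lambda>x. Max ((\<lambda>i. x \<bullet> p i + b i) ` {1..N}))"
proof -
  let ?I = "{1..N}" and ?M = "weighted_lebesgue \<Omega> f"
  let ?l = "\<lambda>i x. x \<bullet> p i"
  have \<Omega>: "open \<Omega>" "\<Omega> \<noteq> {}" "bounded \<Omega>" "convex \<Omega>"
    using assms(1) by (auto simp: bounded_convex_domain_def)
  have I: "finite ?I" "?I \<noteq> {}" using \<open>N \<ge> 1\<close> by auto
  have p: "p ` ?I \<subseteq> closure \<Omega>'" using assms(5) by auto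
  note f = assms(7,8)
  interpret M: finite_measure ?M by (rule finite_measure_weighted_lebesgue[OF f])
  have l_meas: "?l i \<in> borel_measurable ?M" for i
  proof -
    have "?l i \<in> borel_measurable lebesgue"
      by (intro measurable_completion) simp
    then show ?thesis by (simp add: weighted_lebesgue_def)
  qed
  have l_int: "integrable ?M (?l i)" for i
  proof -
    obtain B where B: "\<And>x. x \<in> \<Omega> \<Longrightarrow> norm x \<le> B"
      using \<Omega>(3) by (auto simp: bounded_iff)
    show ?thesis
    proof (rule M.integrable_const_bound[OF _ l_meas])
      have "norm (x \<bullet> p i) \<le> B * norm (p i)" if "x \<in> \<Omega>" for x
        using Cauchy_Schwarz_ineq2[of x "p i"] mult_right_mono[OF B[OF that], of "norm (p i)"]
        by auto
      then show "AE x in ?M. norm (x \<bullet> p i) \<le> B * norm (p i)"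
        by (intro AE_weighted_lebesgueI[OF f(1)] AE_I2 impI)
    qed
  qed
  have mass: "(\<Sum>i\<in>?I. g i) = measure ?M (space ?M)"
  proof -
    have "measure ?M (closure \<Omega>) = (\<Sum>i\<in>?I. g i)"
      using measure_weighted_lebesgue[OF f _ _ \<Omega>(1,4), of "closure \<Omega>"] assms(9) by simp
    moreover have "measure ?M (closure \<Omega>) = measure ?M (space ?M)"
    proof (rule measure_eq_AE[OF AE_weighted_lebesgueI[OF f(1)]])
      show "AE x\<in>\<Omega> in lebesgue. x \<in> closure \<Omega> \<longleftrightarrow> x \<in> space ?M"
        using closure_subset[of \<Omega>] by (intro AE_I2) auto
    qed auto
    ultimately show ?thesis by simp
  qed
  have ties: "AE x in ?M. x \<bullet> p i - x \<bullet> p j \<noteq> c" if "i \<in> ?I" "j \<in> ?I" "i \<noteq> j" for i j c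
  proof (rule AE_weighted_lebesgueI[OF f(1)])
    have "p i \<noteq> p j" by (rule inj_on_contraD[OF assms(4) that(3,1,2)])
    from AE_notin_negligible[OF negligible_ridge[OF this, of c]]
    show "AE x\<in>\<Omega> in lebesgue. x \<bullet> p i - x \<bullet> p j \<noteq> c" by eventually_elim simp
  qed
  obtain b0 where b0: "\<And>i. i \<in> ?I \<Longrightarrow> measure ?M (space ?M \<inter> power_cell ?I p b0 i) = g i"
    using M.exists_prescribed_cell_measures[where l = ?l and g = g, OF I l_int assms(6) mass ties] by blast
  \<comment> \<open>A common constant changes no cell and makes all shifts positive.\<close>
  define b where "b i = b0 i + (1 + (\<Sum>j\<in>?I. \<bar>b0 j\<bar>))" for i
  have b_pos: "b i > 0" if "i \<in> ?I" for i
  proof -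
    have "\<bar>b0 i\<bar> \<le> (\<Sum>j\<in>?I. \<bar>b0 j\<bar>)" using that by (intro member_le_sum) auto
    then show ?thesis by (simp add: b_def)
  qed
  have cells: "measure ?M (power_cell ?I p b i) = g i" if "i \<in> ?I" for i
  proof -
    have "power_cell ?I p b i = power_cell ?I p b0 i"
      using that b_def by (rule envelope_cell_shift)
    then show ?thesis using b0[OF that] by simp
  qed
  let ?u = "affine_envelope ?I p b"
  have preimage: "subdifferential_preimage \<Omega> \<Omega>' ?u E \<in> sets lebesgue \<and>
      (LINT x:subdifferential_preimage \<Omega> \<Omega>' ?u E|lebesgue. f x) = measure (dirac_sum N g p) E"
    if E: "E \<in> sets borel" for E
  proof -
    let ?P = "subdifferential_preimage \<Omega> \<Omega>' ?u E" and ?J = "{i \<in> ?I. p i \<in> E}"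
    let ?C = "\<Union>i\<in>?J. power_cell ?I p b i"
    have J: "?J \<subseteq> ?I" by auto
    have cell_sets: "power_cell ?I p b i \<in> sets lebesgue" if "i \<in> ?I" for i
      using M.sets_envelope_cell[where l = ?l, OF I(1) that l_meas, of b] by simp
    then have C: "?C \<in> sets lebesgue" by (intro sets.finite_UN) auto
    have null: "negligible ((\<Omega> \<inter> ?C - ?P) \<union> (?P - \<Omega> \<inter> ?C))"
      by (rule subdifferential_preimage_symdiff_cells[OF I assms(4) p \<Omega>(1,4)])
    have P: "?P \<in> sets lebesgue"
      using null by (rule sets_negligible_symdiff[rotated]) (use C \<Omega>(1) in auto)
    have "(LINT x:?P|lebesgue. f x) = measure ?M ?P"
      by (rule measure_weighted_lebesgue[OF f P _ \<Omega>(1,4), symmetric])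
        (auto simp: subdifferential_preimage_def)
    also have "\<dots> = measure ?M ?C"
    proof (rule measure_eq_AE[OF AE_weighted_lebesgueI[OF f(1)]])
      show "AE x\<in>\<Omega> in lebesgue. x \<in> ?P \<longleftrightarrow> x \<in> ?C"
        using AE_notin_negligible[OF null] by eventually_elim blast
    qed (use P C in auto)
    also have "\<dots> = (\<Sum>i\<in>?J. measure ?M (power_cell ?I p b i))"
      using M.measure_union_envelope_cells[where l = ?l and b = b, OF I(1) J l_meas ties]
      by simp
    also have "\<dots> = (\<Sum>i\<in>?J. g i)" using cells by (intro sum.cong) auto
    also have "\<dots> = measure (dirac_sum N g p) E"
      by (rule measure_dirac_sum[OF E assms(6), symmetric])
    finally show ?thesis using P by blast
  qed
  have "solves_second_bvp \<Omega> \<Omega>' f (dirac_sum N g p) ?u"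
    unfolding solves_second_bvp_def
  proof (intro conjI[OF _ conjI] ballI impI)
    show "?u \<in> admissible_functions \<Omega> \<Omega>'"
      by (rule affine_envelope_admissible[OF I p \<Omega>(4)])
    show "subdifferential_image \<Omega> \<Omega>' ?u = closure \<Omega>'"
      by (rule subdifferential_image_eq_closure[OF \<Omega>(3,2) continuous_on_affine_envelope[OF I]])
  qed (rule preimage)
  then have "solves_second_bvp \<Omega> \<Omega>' f (dirac_sum N g p) (\<lambda>x. Max ((\<lambda>i. x \<bullet> p i + b i) ` ?I))"
    unfolding upper_envelope_def[abs_def] .
  with b_pos show ?thesis by (intro exI[of _ b] conjI ballI)
qed

end
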